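(* Let $1<\alpha<2$, $0\le\gamma<1$ and let $p,q,p_1,q_1$ be positive reals with $\frac1p+\frac1q=\frac1{p_1}+\frac1{q_1}=1$, $q<\alpha$, $\gamma p<1$, $\gamma q_1<1$, $(q-1)p_1<1$. Let $V$ and $W$ be two random variables on $\mathbb{R}^d$ with probability laws $\mu$ and $\nu$ respectively, such that $\max\{(\mathbb{E}\|W\|^{\gamma p})^{1/p},(\mathbb{E}\|V\|^{\gamma p})^{1/p}\}<\infty$, and let $g\in C^1(\mathbb{R}^d,\mathbb{R})$. Assume that for some $c_1>0$, $c_2\ge0$, $$\|\nabla g(x)\|\le c_1\|x\|^\gamma+c_2\qquad\text{for all }x\in\mathbb{R}^d.$$ Then $$\Big|\int g\,d\mu-\int g\,d\nu\Big|\le\Big(c_1\big(\mathbb{E}\|W\|^{\gamma p}\big)^{\frac1p}+c_1\big(\mathbb{E}\|V\|^{\gamma p}\big)^{\frac1p}+c_2\Big)\mathcal W_q(\mu,\nu).$$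
   Context: $\mathcal W_q(\mu,\nu)=(\inf\mathbb{E}\|V'-W'\|^q)^{1/q}$, where the infimum is over all couplings $V'\sim\mu$, $W'\sim\nu$; $\|\cdot\|$ is the Euclidean norm. *)

theory Defs
  imports "HOL-Probability.Probability"
begin

text \<open>Powers \<open>x\<^sup>a\<close> for \<open>x \<ge> 0\<close>, \<open>a \<ge> 0\<close> with \<open>0\<^sup>0 = 1\<close>; the library's \<open>powr\<close> has \<open>0 powr 0 = 0\<close>,
  which would be wrong for \<open>\<parallel>x\<parallel>\<^sup>\<gamma>\<close> with \<open>\<gamma> = 0\<close>.\<close>

definition rpow :: "real \<Rightarrow> real \<Rightarrow> real" where
  "rpow x a = (if a = 0 then 1 else x powr a)"

text \<open>Intended for exponents \<open>a > 0\<close> only.\<close>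

definition ennpow :: "ennreal \<Rightarrow> real \<Rightarrow> ennreal" where
  "ennpow x a = (if x = \<infinity> then \<infinity> else ennreal (enn2real x powr a))"

text \<open>A pair \<open>(V', W')\<close> on some probability space with \<open>V' \<sim> \<mu>\<close> and \<open>W' \<sim> \<nu>\<close> is represented by its
  joint law.\<close>

definition couplings ::
  "'v::euclidean_space measure \<Rightarrow> 'v measure \<Rightarrow> ('v \<times> 'v) measure set" where
  "couplings \<mu> \<nu> = {\<pi>. prob_space \<pi> \<and> sets \<pi> = sets (borel \<Otimes>\<^sub>M borel) \<and>
     distr \<pi> borel fst = \<mu> \<and> distr \<pi> borel snd = \<nu>}"

text \<open>The value may be \<open>\<infinity>\<close>: no finiteness of \<open>q\<close>-th moments is assumed.\<close>

definition wasserstein ::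
  "real \<Rightarrow> 'v::euclidean_space measure \<Rightarrow> 'v measure \<Rightarrow> ennreal" where
  "wasserstein q \<mu> \<nu> =
     ennpow (INF \<pi>\<in>couplings \<mu> \<nu>. \<integral>\<^sup>+z. ennreal (rpow (norm (fst z - snd z)) q) \<partial>\<pi>) (1 / q)"

end

theory Submission
  imports Defs
begin

text \<open>By the mean value inequality, \<open>\<bar>g x - g y\<bar> \<le> (c1 (\<parallel>x\<parallel>\<^sup>\<gamma> + \<parallel>y\<parallel>\<^sup>\<gamma>) + c2) \<parallel>x - y\<parallel>\<close>, because the
  norm along the segment from \<open>x\<close> to \<open>y\<close> is at most the larger of the norms of the endpoints.
  Integrating against a coupling and applying Hoelder's inequality with the exponents \<open>p\<close> and \<open>q\<close> to each
  summand gives the claim with the transport cost of the coupling in place of the infimum.\<close>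

section \<open>Powers of nonnegative and of extended reals\<close>

lemma rpow_nonneg [simp]: "0 \<le> x \<Longrightarrow> 0 \<le> rpow x a"
  by (simp add: rpow_def)

lemma rpow_mono: "0 \<le> a \<Longrightarrow> 0 \<le> x \<Longrightarrow> x \<le> y \<Longrightarrow> rpow x a \<le> rpow y a"
  by (simp add: rpow_def powr_mono2)

text \<open>For positive \<open>b\<close> the product \<open>a * b\<close> vanishes exactly when
  \<open>a\<close> does, so both sides fall under the convention for exponent 0 at the same
  time.\<close>

lemma rpow_powr: "0 < b \<Longrightarrow> rpow x a powr b = rpow x (a * b)"
  by (simp add: rpow_def powr_powr)

lemma borel_measurable_rpow [measurable]:
  "f \<in> borel_measurable M \<Longrightarrow> (\<lambda>x. rpow (f x) a) \<in> borel_measurable M"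
  by (cases "a = 0") (simp_all add: rpow_def)

lemma ennpow_top [simp]: "ennpow top a = top"
  by (simp add: ennpow_def)

lemma ennpow_ennreal [simp]: "0 \<le> x \<Longrightarrow> ennpow (ennreal x) a = ennreal (x powr a)"
  by (simp add: ennpow_def)

lemma ennpow_one [simp]: "ennpow 1 a = 1"
  by (simp add: ennpow_def)

lemma ennpow_eq_0_iff: "ennpow x a = 0 \<longleftrightarrow> x = 0"
  by (cases x) (auto simp: ennreal_eq_0_iff)

lemma ennpow_mono: "0 \<le> a \<Longrightarrow> x \<le> y \<Longrightarrow> ennpow x a \<le> ennpow y a"
  by (cases x; cases y) (auto simp: top_unique intro!: ennreal_leI powr_mono2)

lemma ennpow_inverse: "0 < a \<Longrightarrow> ennpow (ennpow x a) (1 / a) = x"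
  by (cases x) (auto simp: powr_powr)

text \<open>For positive \<open>a\<close> the power is an increasing bijection of the extended
  half-line, with inverse the power \<open>1 / a\<close>, and order isomorphisms preserve
  infima.\<close>

lemma ennpow_INF:
  assumes "0 < a"
  shows "ennpow (INF i\<in>I. f i) a = (INF i\<in>I. ennpow (f i) a)"
proof (rule antisym)
  show "ennpow (INF i\<in>I. f i) a \<le> (INF i\<in>I. ennpow (f i) a)"
    using assms by (intro INF_greatest ennpow_mono INF_lower) auto
next
  define y where "y = (INF i\<in>I. ennpow (f i) a)"
  have "ennpow y (1 / a) \<le> f i" if "i \<in> I" for i
  proof -
    have "ennpow y (1 / a) \<le> ennpow (ennpow (f i) a) (1 / a)"
      unfolding y_def using assms that by (intro ennpow_mono INF_lower) auto
    then show ?thesis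
      using assms by (simp add: ennpow_inverse)
  qed
  then have "ennpow (ennpow y (1 / a)) a \<le> ennpow (INF i\<in>I. f i) a"
    using assms by (intro ennpow_mono INF_greatest) auto
  then show "y \<le> ennpow (INF i\<in>I. f i) a"
    using assms ennpow_inverse[of "1 / a" y] by simp
qed

text \<open>This carries a bound valid for each coupling over to the infimum. Finiteness of
  \<open>c\<close> matters: if \<open>c = top\<close> and the \<open>f i\<close> are positive with
  infimum 0, every \<open>c * f i\<close> is infinite but the product with the infimum is 0.\<close>

lemma ennreal_le_mult_INF:
  fixes c x :: ennreal
  assumes "I \<noteq> {}" "c \<noteq> top" "\<And>i. i \<in> I \<Longrightarrow> x \<le> c * f i"
  shows "x \<le> c * (INF i\<in>I. f i)"
proof (cases "c = 0")
  \<comment> \<open>Any single index already gives \<open>x = 0\<close>. An empty infimum would be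
    \<open>top\<close>, and \<open>0 * top = 0\<close> would bound nothing.\<close>
  case True
  then show ?thesis
    using assms by auto
next
  case False
  have "x / c \<le> (INF i\<in>I. f i)"
    using False assms(3) by (intro INF_greatest divide_le_posI_ennreal) (auto simp: zero_less_iff_neq_zero)
  then have "c * (x / c) \<le> c * (INF i\<in>I. f i)"
    by (rule mult_left_mono) simp
  moreover have "c * (x / c) = x"
    using False assms(2) by (simp add: ennreal_times_divide ennreal_mult_divide_eq mult.commute[of c])
  ultimately show ?thesis
    by simp
qed

section \<open>Hoelder's inequality for nonnegative integrals\<close>

lemma nn_integral_Hoelder:
  fixes f g :: "'a \<Rightarrow> real"
  assumes "0 < p" "0 < q" "1 / p + 1 / q = 1"
    and [measurable]: "f \<in> borel_measurable M" "g \<in> borel_measurable M"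
    and nonneg: "\<And>x. 0 \<le> f x" "\<And>x. 0 \<le> g x"
  shows "(\<integral>\<^sup>+x. ennreal (f x * g x) \<partial>M)
    \<le> ennpow (\<integral>\<^sup>+x. ennreal (f x powr p) \<partial>M) (1 / p) * ennpow (\<integral>\<^sup>+x. ennreal (g x powr q) \<partial>M) (1 / q)"
    (is "?L \<le> ennpow ?A _ * ennpow ?B _")
proof -
  have zero: "?L = 0" if "?A = 0 \<or> ?B = 0"
  proof -
    have "(AE x in M. f x = 0) \<or> (AE x in M. g x = 0)"
      using that by (simp add: nn_integral_0_iff_AE ennreal_eq_0_iff)
    then have "AE x in M. f x * g x = 0"
      by auto
    then show ?thesis
      by (simp add: nn_integral_0_iff_AE) (auto elim: AE_mp)
  qed
  \<comment> \<open>Vanishing integrals are separated first: since \<open>0 * top = 0\<close>, an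
    infinite integral makes the right-hand side infinite only if the other one is nonzero.\<close>
  consider "?A = 0 \<or> ?B = 0" | "?A \<noteq> 0" "?B \<noteq> 0" "?A = top \<or> ?B = top"
    | "?A \<noteq> 0" "?B \<noteq> 0" "?A \<noteq> top" "?B \<noteq> top"
    by blast
  then show ?thesis
  proof cases
    case 1
    then show ?thesis
      using zero by simp
  next
    case 2
    then have "ennpow ?A (1 / p) * ennpow ?B (1 / q) = top"
      by (auto simp: ennreal_mult_eq_top_iff ennpow_eq_0_iff)
    then show ?thesis
      by simp
  next
    case 3
    have pos: "\<exists>r>0. x = ennreal r" if "x \<noteq> 0" "x \<noteq> top" for x :: ennreal
      using that by (cases x) (auto simp: order_le_less)
    obtain a b where a: "?A = ennreal a" "0 < a" and b: "?B = ennreal b" "0 < b"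
      using pos[OF 3(1,3)] pos[OF 3(2,4)] by blast
    \<comment> \<open>These are the L^p norm of \<open>f\<close> and the L^q norm of
      \<open>g\<close>; dividing by them normalises both functions.\<close>
    define s t where "s = a powr (1 / p)" and "t = b powr (1 / q)"
    have s: "0 < s" "s powr p = a" and t: "0 < t" "t powr q = b"
      using a(2) b(2) assms(1,2) by (simp_all add: s_def t_def powr_powr)
    have "1 / p < 1" "1 / q < 1"
      using assms(3) divide_pos_pos[OF zero_less_one assms(1)] divide_pos_pos[OF zero_less_one assms(2)]
      by linarith+
    then have pq: "p > 1" "q > 1"
      using assms(1,2) by (simp_all add: divide_less_eq)
    \<comment> \<open>Young's inequality for \<open>f x / s\<close> and \<open>g x / t\<close>,
      multiplied by \<open>s * t\<close>; the denominators \<open>a\<close> and \<open>b\<close> are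
      \<open>s powr p\<close> and \<open>t powr q\<close>.\<close>
    have "f x * g x \<le> s * t / (a * p) * f x powr p + s * t / (b * q) * g x powr q" for x
    proof -
      have "f x / s * (g x / t) \<le> (f x / s) powr p / p + (g x / t) powr q / q"
        using pq assms(3) nonneg s(1) t(1) by (intro Youngs_inequality) auto
      also have "\<dots> = f x powr p / (a * p) + g x powr q / (b * q)"
        using nonneg s t by (simp add: powr_divide)
      finally have "s * t * (f x / s * (g x / t)) \<le> s * t * (f x powr p / (a * p) + g x powr q / (b * q))"
        using s t by (intro mult_left_mono) auto
      then show ?thesis
        using s t by (simp add: algebra_simps)
    qed
    then have "?L \<le> (\<integral>\<^sup>+x. ennreal (s * t / (a * p)) * ennreal (f x powr p)
        + ennreal (s * t / (b * q)) * ennreal (g x powr q) \<partial>M)"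
      using s(1) t(1) a(2) b(2) assms(1,2)
      by (intro nn_integral_mono) (simp add: ennreal_mult[symmetric] ennreal_plus[symmetric] del: ennreal_plus)
    also have "\<dots> = ennreal (s * t / (a * p)) * ?A + ennreal (s * t / (b * q)) * ?B"
      by (simp add: nn_integral_add nn_integral_cmult)
    also have "\<dots> = ennreal (s * t / (a * p) * a + s * t / (b * q) * b)"
      using s(1) t(1) a b assms(1,2)
      by (simp add: ennreal_mult[symmetric] ennreal_plus[symmetric] del: ennreal_plus)
    also have "s * t / (a * p) * a + s * t / (b * q) * b = s * t * (1 / p + 1 / q)"
      using a(2) b(2) assms(1,2) by (simp add: field_simps)
    also have "ennreal \<dots> = ennpow ?A (1 / p) * ennpow ?B (1 / q)"
      using a b by (simp add: assms(3) s_def t_def ennreal_mult)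
    finally show ?thesis .
  qed
qed

section \<open>Mean value inequality under gradient growth\<close>

lemma gradient_growth_imp_diff_bound:
  fixes g :: "'v::euclidean_space \<Rightarrow> real"
  assumes deriv: "\<And>x. GDERIV g x :> grad_g x"
    and growth: "\<And>x. norm (grad_g x) \<le> c1 * rpow (norm x) \<gamma> + c2"
    and nonneg: "0 \<le> c1" "0 \<le> \<gamma>"
  shows "\<bar>g x - g y\<bar> \<le> (c1 * (rpow (norm x) \<gamma> + rpow (norm y) \<gamma>) + c2) * norm (x - y)"
proof -
  have "norm (g x - g y) \<le> (c1 * (rpow (norm x) \<gamma> + rpow (norm y) \<gamma>) + c2) * norm (x - y)"
  proof (rule differentiable_bound[where S = "closed_segment x y" and f' = "\<lambda>z h. h \<bullet> grad_g z"])
    fix z assume z: "z \<in> closed_segment x y"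
    show "(g has_derivative (\<lambda>h. h \<bullet> grad_g z)) (at z within closed_segment x y)"
      using deriv[of z] unfolding gderiv_def by (rule has_derivative_at_withinI)
    \<comment> \<open>The ball is convex and contains both endpoints, hence the whole
      segment.\<close>
    have "z \<in> cball 0 (max (norm x) (norm y))"
      by (rule subsetD[OF closed_segment_subset z]) auto
    then have "rpow (norm z) \<gamma> \<le> rpow (max (norm x) (norm y)) \<gamma>"
      using nonneg by (intro rpow_mono) auto
    \<comment> \<open>The maximum is one of the two norms, and the power of the other is
      nonnegative. The sum separates the two marginals later on.\<close>
    also have "\<dots> \<le> rpow (norm x) \<gamma> + rpow (norm y) \<gamma>"
      by (auto simp: max_def)
    finally have "c1 * rpow (norm z) \<gamma> \<le> c1 * (rpow (norm x) \<gamma> + rpow (norm y) \<gamma>)"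
      using nonneg by (intro mult_left_mono)
    then have *: "norm (grad_g z) \<le> c1 * (rpow (norm x) \<gamma> + rpow (norm y) \<gamma>) + c2"
      using growth[of z] by simp
    \<comment> \<open>By Cauchy-Schwarz the operator norm of the derivative is at most the norm of
      the gradient.\<close>
    show "onorm (\<lambda>h. h \<bullet> grad_g z) \<le> c1 * (rpow (norm x) \<gamma> + rpow (norm y) \<gamma>) + c2"
    proof (rule onorm_le)
      fix h
      have "norm (h \<bullet> grad_g z) \<le> norm (grad_g z) * norm h"
        by (metis Cauchy_Schwarz_ineq2 mult.commute real_norm_def)
      also have "\<dots> \<le> (c1 * (rpow (norm x) \<gamma> + rpow (norm y) \<gamma>) + c2) * norm h"
        using * by (intro mult_right_mono) auto
      finally show "norm (h \<bullet> grad_g z) \<le> (c1 * (rpow (norm x) \<gamma> + rpow (norm y) \<gamma>) + c2) * norm h" .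
    qed
  qed auto
  then show ?thesis
    by simp
qed

section \<open>Couplings and their transport cost\<close>

text \<open>The independent coupling serves to show that the infimum defining the Wasserstein
  distance runs over a nonempty set.\<close>

lemma pair_measure_in_couplings:
  assumes "prob_space \<mu>" "prob_space \<nu>" and [simp]: "sets \<mu> = sets borel" "sets \<nu> = sets borel"
  shows "\<mu> \<Otimes>\<^sub>M \<nu> \<in> couplings \<mu> \<nu>"
proof -
  interpret \<mu>: prob_space \<mu> by fact
  interpret \<nu>: prob_space \<nu> by fact
  interpret pair_prob_space \<mu> \<nu> ..
  have space: "space \<mu> = UNIV" "space \<nu> = UNIV"
    by (simp_all add: sets_eq_imp_space_eq[of _ borel])
  have sets: "sets (\<mu> \<Otimes>\<^sub>M \<nu>) = sets (borel \<Otimes>\<^sub>M borel)"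
    by (intro sets_pair_measure_cong) simp_all
  have meas: "fst \<in> \<mu> \<Otimes>\<^sub>M \<nu> \<rightarrow>\<^sub>M borel" "snd \<in> \<mu> \<Otimes>\<^sub>M \<nu> \<rightarrow>\<^sub>M borel"
    by (simp_all add: measurable_cong_sets[OF sets refl])
  have 1: "distr (\<mu> \<Otimes>\<^sub>M \<nu>) borel fst = \<mu>"
  proof (rule measure_eqI)
    fix A assume "A \<in> sets (distr (\<mu> \<Otimes>\<^sub>M \<nu>) borel fst)"
    then have A: "A \<in> sets borel"
      by simp
    \<comment> \<open>The preimage of \<open>A\<close> is a cylinder, and its second factor has mass
      1.\<close>
    have "emeasure (distr (\<mu> \<Otimes>\<^sub>M \<nu>) borel fst) A = emeasure (\<mu> \<Otimes>\<^sub>M \<nu>) (A \<times> space \<nu>)"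
      using A meas by (auto simp: emeasure_distr space_pair_measure space intro!: arg_cong2[where f = emeasure])
    also have "\<dots> = emeasure \<mu> A"
      using A by (subst \<nu>.emeasure_pair_measure_Times) (auto simp: space \<nu>.emeasure_space_1[unfolded space])
    finally show "emeasure (distr (\<mu> \<Otimes>\<^sub>M \<nu>) borel fst) A = emeasure \<mu> A" .
  qed simp
  have 2: "distr (\<mu> \<Otimes>\<^sub>M \<nu>) borel snd = \<nu>"
  proof (rule measure_eqI)
    fix A assume "A \<in> sets (distr (\<mu> \<Otimes>\<^sub>M \<nu>) borel snd)"
    then have A: "A \<in> sets borel"
      by simp
    have "emeasure (distr (\<mu> \<Otimes>\<^sub>M \<nu>) borel snd) A = emeasure (\<mu> \<Otimes>\<^sub>M \<nu>) (space \<mu> \<times> A)"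
      using A meas by (auto simp: emeasure_distr space_pair_measure space intro!: arg_cong2[where f = emeasure])
    also have "\<dots> = emeasure \<nu> A"
      using A by (subst \<nu>.emeasure_pair_measure_Times) (auto simp: space \<mu>.emeasure_space_1[unfolded space])
    finally show "emeasure (distr (\<mu> \<Otimes>\<^sub>M \<nu>) borel snd) A = emeasure \<nu> A" .
  qed simp
  show ?thesis
    unfolding couplings_def using 1 2 sets prob_space_axioms by blast
qed

lemma coupling_cost_bound:
  fixes g :: "'v::euclidean_space \<Rightarrow> real"
  assumes \<pi>: "\<pi> \<in> couplings \<mu> \<nu>"
    and pq: "0 < p" "0 < q" "1 / p + 1 / q = 1"
    and nonneg: "0 \<le> c1" "0 \<le> c2"
    and diff: "\<And>x y. \<bar>g x - g y\<bar> \<le> (c1 * (rpow (norm x) \<gamma> + rpow (norm y) \<gamma>) + c2) * norm (x - y)"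
  shows "(\<integral>\<^sup>+z. ennreal \<bar>g (fst z) - g (snd z)\<bar> \<partial>\<pi>)
    \<le> (ennreal c1 * ennpow (\<integral>\<^sup>+x. ennreal (rpow (norm x) (\<gamma> * p)) \<partial>\<nu>) (1 / p)
        + ennreal c1 * ennpow (\<integral>\<^sup>+x. ennreal (rpow (norm x) (\<gamma> * p)) \<partial>\<mu>) (1 / p)
        + ennreal c2) * ennpow (\<integral>\<^sup>+z. ennreal (rpow (norm (fst z - snd z)) q) \<partial>\<pi>) (1 / q)"
proof -
  interpret prob_space \<pi>
    using \<pi> by (simp add: couplings_def)
  have sets[measurable_cong]: "sets \<pi> = sets (borel \<Otimes>\<^sub>M borel)"
    and \<mu>: "\<mu> = distr \<pi> borel fst" and \<nu>: "\<nu> = distr \<pi> borel snd"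
    using \<pi> by (auto simp: couplings_def)
  let ?D = "\<lambda>z::'v \<times> 'v. norm (fst z - snd z)"
  let ?F = "\<lambda>z::'v \<times> 'v. rpow (norm (fst z)) \<gamma>" and ?S = "\<lambda>z::'v \<times> 'v. rpow (norm (snd z)) \<gamma>"
  let ?I = "ennpow (\<integral>\<^sup>+z. ennreal (rpow (?D z) q) \<partial>\<pi>) (1 / q)"
  \<comment> \<open>The distance is the L^q factor throughout; \<open>h\<close> will be
    \<open>?S\<close>, \<open>?F\<close> and the constant 1.\<close>
  have Hoelder: "(\<integral>\<^sup>+z. ennreal (h z * ?D z) \<partial>\<pi>) \<le> ennpow (\<integral>\<^sup>+z. ennreal (h z powr p) \<partial>\<pi>) (1 / p) * ?I"
    if "h \<in> borel_measurable \<pi>" "\<And>z. 0 \<le> h z" for h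
    using nn_integral_Hoelder[OF pq that(1) _ that(2), of ?D] pq by (simp add: rpow_def)
  have "(\<integral>\<^sup>+z. ennreal \<bar>g (fst z) - g (snd z)\<bar> \<partial>\<pi>)
      \<le> (\<integral>\<^sup>+z. ennreal c1 * ennreal (?S z * ?D z) + ennreal c1 * ennreal (?F z * ?D z)
            + ennreal c2 * ennreal (1 * ?D z) \<partial>\<pi>)"
  proof (rule nn_integral_mono)
    fix z
    have "\<bar>g (fst z) - g (snd z)\<bar> \<le> c1 * (?S z * ?D z) + c1 * (?F z * ?D z) + c2 * (1 * ?D z)"
      using diff[of "fst z" "snd z"] by (simp add: algebra_simps)
    then show "ennreal \<bar>g (fst z) - g (snd z)\<bar> \<le> ennreal c1 * ennreal (?S z * ?D z)
        + ennreal c1 * ennreal (?F z * ?D z) + ennreal c2 * ennreal (1 * ?D z)"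
      using nonneg by (simp add: ennreal_mult'[symmetric] ennreal_plus[symmetric] ennreal_leI del: ennreal_plus)
  qed
  also have "\<dots> = ennreal c1 * (\<integral>\<^sup>+z. ennreal (?S z * ?D z) \<partial>\<pi>)
      + ennreal c1 * (\<integral>\<^sup>+z. ennreal (?F z * ?D z) \<partial>\<pi>) + ennreal c2 * (\<integral>\<^sup>+z. ennreal (1 * ?D z) \<partial>\<pi>)"
    by (simp add: nn_integral_add nn_integral_cmult)
  \<comment> \<open>The \<open>c2\<close> term also gets the factor \<open>?I\<close>, because the
    constant 1 has L^p norm 1 under a probability measure.\<close>
  also have "\<dots> \<le> ennreal c1 * (ennpow (\<integral>\<^sup>+z. ennreal (?S z powr p) \<partial>\<pi>) (1 / p) * ?I)
      + ennreal c1 * (ennpow (\<integral>\<^sup>+z. ennreal (?F z powr p) \<partial>\<pi>) (1 / p) * ?I)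
      + ennreal c2 * (ennpow (\<integral>\<^sup>+z. ennreal (1 powr p) \<partial>\<pi>) (1 / p) * ?I)"
    by (intro add_mono mult_left_mono Hoelder) auto
  \<comment> \<open>A function of one coordinate integrates against \<pi> as against the
    corresponding marginal, so the L^p norms of \<open>?S\<close> and \<open>?F\<close> become
    moments of \<nu> and \<mu>.\<close>
  finally show ?thesis
    using pq(1) by (simp add: \<mu> \<nu> nn_integral_distr rpow_powr emeasure_space_1 distrib_right mult.assoc)
qed

text \<open>When the right-hand side is finite, the difference of \<open>g (fst z)\<close> and
  \<open>g (snd z)\<close> is integrable, so these two are integrable together or not at all.
  Linearity of the integral settles the first case.\<close>

lemma coupling_integral_diff_bound:
  fixes g :: "'v::euclidean_space \<Rightarrow> real"
  assumes \<pi>: "\<pi> \<in> couplings \<mu> \<nu>" and [measurable]: "g \<in> borel_measurable borel"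
  shows "ennreal \<bar>(\<integral>x. g x \<partial>\<mu>) - (\<integral>x. g x \<partial>\<nu>)\<bar> \<le> (\<integral>\<^sup>+z. ennreal \<bar>g (fst z) - g (snd z)\<bar> \<partial>\<pi>)"
proof (cases "(\<integral>\<^sup>+z. ennreal \<bar>g (fst z) - g (snd z)\<bar> \<partial>\<pi>) = top")
  case False
  have sets[measurable_cong]: "sets \<pi> = sets (borel \<Otimes>\<^sub>M borel)"
    and \<mu>: "\<mu> = distr \<pi> borel fst" and \<nu>: "\<nu> = distr \<pi> borel snd"
    using \<pi> by (auto simp: couplings_def)
  have d: "integrable \<pi> (\<lambda>z. g (fst z) - g (snd z))"
    using False by (simp add: integrable_iff_bounded top.not_eq_extremum)
  have eq: "(\<integral>x. g x \<partial>\<mu>) = (\<integral>z. g (fst z) \<partial>\<pi>)" "(\<integral>x. g x \<partial>\<nu>) = (\<integral>z. g (snd z) \<partial>\<pi>)"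
    by (simp_all add: \<mu> \<nu> integral_distr)
  show ?thesis
  proof (cases "integrable \<pi> (\<lambda>z. g (fst z))")
    case True
    have "integrable \<pi> (\<lambda>z. g (snd z))"
      using Bochner_Integration.integrable_diff[OF True d] by simp
    then show ?thesis
      using True integral_norm_bound_ennreal[OF d] by (simp add: eq)
  next
    \<comment> \<open>Then \<open>g\<close> is integrable for neither law, and both integrals are \<open>0\<close> by convention.\<close>
    case False
    have "\<not> integrable \<pi> (\<lambda>z. g (snd z))"
      using False Bochner_Integration.integrable_add[OF _ d, of "\<lambda>z. g (snd z)"] by auto
    with False show ?thesis
      by (simp add: eq not_integrable_integral_eq)
  qed
qed simp

section \<open>Passage to the infimum over all couplings\<close>

theorem lemmaS6:
  fixes \<alpha> \<gamma> p q p1 q1 c1 c2 :: real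
    and M :: "'a measure" and N :: "'b measure"
    and V :: "'a \<Rightarrow> real ^ 'd" and W :: "'b \<Rightarrow> real ^ 'd"
    and \<mu> \<nu> :: "(real ^ 'd) measure"
    and g :: "real ^ 'd \<Rightarrow> real" and grad_g :: "real ^ 'd \<Rightarrow> real ^ 'd"
  assumes "1 < \<alpha>" "\<alpha> < 2"
    and "0 \<le> \<gamma>" "\<gamma> < 1"
    and "0 < p" "0 < q" "0 < p1" "0 < q1"
    and "1 / p + 1 / q = 1" "1 / p1 + 1 / q1 = 1"
    and "q < \<alpha>" "\<gamma> * p < 1" "\<gamma> * q1 < 1" "(q - 1) * p1 < 1"
    and "prob_space M" "prob_space N"
    and "V \<in> borel_measurable M" "W \<in> borel_measurable N"
    and "\<mu> = distr M borel V" "\<nu> = distr N borel W"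
    and "max (ennpow (\<integral>\<^sup>+\<omega>. ennreal (rpow (norm (W \<omega>)) (\<gamma> * p)) \<partial>N) (1 / p))
             (ennpow (\<integral>\<^sup>+\<omega>. ennreal (rpow (norm (V \<omega>)) (\<gamma> * p)) \<partial>M) (1 / p)) < \<infinity>"
    and "\<And>x. GDERIV g x :> grad_g x" "continuous_on UNIV grad_g"
    and "0 < c1" "0 \<le> c2"
    and "\<And>x. norm (grad_g x) \<le> c1 * rpow (norm x) \<gamma> + c2"
  shows "ennreal \<bar>(\<integral>x. g x \<partial>\<mu>) - (\<integral>x. g x \<partial>\<nu>)\<bar>
    \<le> (ennreal c1 * ennpow (\<integral>\<^sup>+\<omega>. ennreal (rpow (norm (W \<omega>)) (\<gamma> * p)) \<partial>N) (1 / p)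
        + ennreal c1 * ennpow (\<integral>\<^sup>+\<omega>. ennreal (rpow (norm (V \<omega>)) (\<gamma> * p)) \<partial>M) (1 / p)
        + ennreal c2) * wasserstein q \<mu> \<nu>"
proof -
  let ?C = "ennreal c1 * ennpow (\<integral>\<^sup>+\<omega>. ennreal (rpow (norm (W \<omega>)) (\<gamma> * p)) \<partial>N) (1 / p)
        + ennreal c1 * ennpow (\<integral>\<^sup>+\<omega>. ennreal (rpow (norm (V \<omega>)) (\<gamma> * p)) \<partial>M) (1 / p) + ennreal c2"
  note [measurable] = \<open>V \<in> borel_measurable M\<close> \<open>W \<in> borel_measurable N\<close>
  have moments: "(\<integral>\<^sup>+x. ennreal (rpow (norm x) (\<gamma> * p)) \<partial>\<mu>) = (\<integral>\<^sup>+\<omega>. ennreal (rpow (norm (V \<omega>)) (\<gamma> * p)) \<partial>M)"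
    "(\<integral>\<^sup>+x. ennreal (rpow (norm x) (\<gamma> * p)) \<partial>\<nu>) = (\<integral>\<^sup>+\<omega>. ennreal (rpow (norm (W \<omega>)) (\<gamma> * p)) \<partial>N)"
    using assms(19,20) by (simp_all add: nn_integral_distr)
  have "prob_space \<mu>" "prob_space \<nu>"
    using assms(15-20) by (simp_all add: prob_space.prob_space_distr)
  then have ne: "couplings \<mu> \<nu> \<noteq> {}"
    using pair_measure_in_couplings[of \<mu> \<nu>] assms(19,20) by auto
  have "\<And>x. isCont g x"
    using assms(22) by (metis gderiv_def has_derivative_continuous)
  then have g: "g \<in> borel_measurable borel"
    by (intro borel_measurable_continuous_onI) (simp add: continuous_at_imp_continuous_on)
  have diff: "\<bar>g x - g y\<bar> \<le> (c1 * (rpow (norm x) \<gamma> + rpow (norm y) \<gamma>) + c2) * norm (x - y)" for x y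
    using assms(3,22,24,26) by (intro gradient_growth_imp_diff_bound) auto
  have "ennreal \<bar>(\<integral>x. g x \<partial>\<mu>) - (\<integral>x. g x \<partial>\<nu>)\<bar>
      \<le> ?C * ennpow (\<integral>\<^sup>+z. ennreal (rpow (norm (fst z - snd z)) q) \<partial>\<pi>) (1 / q)"
    if "\<pi> \<in> couplings \<mu> \<nu>" for \<pi>
    using order_trans[OF coupling_integral_diff_bound[OF that g] coupling_cost_bound[OF that _ _ _ _ _ diff, of p q]]
      assms(5,6,9,24,25) by (simp add: moments)
  \<comment> \<open>Here the finite moments enter: an infinite constant could not be taken out of an
    infimum equal to 0.\<close>
  moreover have "?C \<noteq> top"
    using assms(21) by (auto simp: ennreal_mult_eq_top_iff)
  ultimately have "ennreal \<bar>(\<integral>x. g x \<partial>\<mu>) - (\<integral>x. g x \<partial>\<nu>)\<bar>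
      \<le> ?C * (INF \<pi>\<in>couplings \<mu> \<nu>. ennpow (\<integral>\<^sup>+z. ennreal (rpow (norm (fst z - snd z)) q) \<partial>\<pi>) (1 / q))"
    using ne by (intro ennreal_le_mult_INF)
  \<comment> \<open>The distance takes the root of the infimum, while the bound has the infimum of
    the roots; \<open>ennpow_INF\<close> with exponent \<open>1 / q\<close> identifies them.\<close>
  then show ?thesis
    using assms(6) by (simp add: wasserstein_def ennpow_INF)
qed

end
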